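(* For integers $t\ge s\ge 3$, we have $$r\!\left(K_{n,n},K_{s,t},\,st-\left\lfloor\tfrac{s+t}{2}\right\rfloor+2\right)=\Omega(n^{3/2}).$$
   Context: For graphs $G,H$ and an integer $q$ with $2\le q\le |E(H)|$, an $(H,q)$-coloring of $G$ is an edge-coloring of $G$ in which every subgraph of $G$ isomorphic to $H$ receives at least $q$ distinct colors; $r(G,H,q)$ is the minimum number of colors needed for $G$ to have an $(H,q)$-coloring. $K_{n,n}$, $K_{s,t}$ denote complete bipartite graphs. Asymptotic notation refers to $n\to\infty$ with $s,t$ fixed. *)

theory Defs
  imports Complex_Main "HOL-Library.Landau_Symbols"
begin

record 'a ugraph =
  verts :: "'a set"
  edges :: "'a set set"

definition simple_graph :: "'a ugraph \<Rightarrow> bool" where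
  "simple_graph G \<longleftrightarrow> edges G \<subseteq> {{u, v} | u v. u \<in> verts G \<and> v \<in> verts G \<and> u \<noteq> v}"

definition is_subgraph :: "'a ugraph \<Rightarrow> 'a ugraph \<Rightarrow> bool" where
  "is_subgraph F G \<longleftrightarrow> simple_graph F \<and> verts F \<subseteq> verts G \<and> edges F \<subseteq> edges G"

definition isomorphic :: "'a ugraph \<Rightarrow> 'b ugraph \<Rightarrow> bool" where
  "isomorphic F H \<longleftrightarrow>
     (\<exists>f. bij_betw f (verts F) (verts H) \<and>
          (\<forall>u \<in> verts F. \<forall>v \<in> verts F. {u, v} \<in> edges F \<longleftrightarrow> {f u, f v} \<in> edges H))"

(* Edge colorings are functions on all vertex sets; only the values on edges matter. *)
definition Hq_coloring :: "'a ugraph \<Rightarrow> 'b ugraph \<Rightarrow> nat \<Rightarrow> ('a set \<Rightarrow> nat) \<Rightarrow> bool" where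
  "Hq_coloring G H q c \<longleftrightarrow>
     (\<forall>F. is_subgraph F G \<and> isomorphic F H \<longrightarrow> card (c ` edges F) \<ge> q)"

(* Meaningful for finite G and q at most the number of edges of H: the minimum then exists,
   since coloring the edges of G with pairwise distinct colors is admissible. *)
definition gen_ramsey :: "'a ugraph \<Rightarrow> 'b ugraph \<Rightarrow> nat \<Rightarrow> nat" where
  "gen_ramsey G H q = (LEAST k. \<exists>c. Hq_coloring G H q c \<and> card (c ` edges G) = k)"

definition complete_bipartite :: "nat \<Rightarrow> nat \<Rightarrow> (nat + nat) ugraph" where
  "complete_bipartite a b =
     \<lparr> verts = Inl ` {..<a} \<union> Inr ` {..<b},
       edges = {{Inl i, Inr j} | i j. i < a \<and> j < b} \<rparr>"

lemma simple_graph_complete_bipartite: "simple_graph (complete_bipartite a b)"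
  unfolding simple_graph_def complete_bipartite_def by (simp, blast)

lemma edges_complete_bipartite:
  "edges (complete_bipartite a b) = (\<lambda>(i, j). {Inl i, Inr j}) ` ({..<a} \<times> {..<b})"
  unfolding complete_bipartite_def by auto

lemma finite_edges_complete_bipartite: "finite (edges (complete_bipartite a b))"
  by (simp add: edges_complete_bipartite)

lemma card_edges_complete_bipartite: "card (edges (complete_bipartite a b)) = a * b"
proof -
  have "inj_on (\<lambda>(i, j). {Inl i, Inr j :: nat + nat}) ({..<a} \<times> {..<b})"
    by (auto simp: inj_on_def doubleton_eq_iff)
  then show ?thesis
    by (simp add: edges_complete_bipartite card_image)
qed

lemma isomorphic_card_edges:
  assumes "isomorphic F H" "simple_graph F" "simple_graph H"
  shows "card (edges F) = card (edges H)"
proof -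
  from assms(1) obtain f where f: "bij_betw f (verts F) (verts H)"
    and adj: "\<And>u v. u \<in> verts F \<Longrightarrow> v \<in> verts F \<Longrightarrow> {u, v} \<in> edges F \<longleftrightarrow> {f u, f v} \<in> edges H"
    unfolding isomorphic_def by auto
  have sub: "edges F \<subseteq> Pow (verts F)"
    using assms(2) unfolding simple_graph_def by blast
  have inj: "inj_on ((`) f) (edges F)"
    using f sub by (meson bij_betw_def inj_on_image_Pow inj_on_subset)
  have "(`) f ` edges F = edges H"
  proof (intro equalityI subsetI)
    fix e assume "e \<in> (`) f ` edges F"
    then obtain d where d: "d \<in> edges F" "e = f ` d" by auto
    then obtain u v where "d = {u, v}" "u \<in> verts F" "v \<in> verts F"
      using assms(2) unfolding simple_graph_def by blast
    then show "e \<in> edges H" using adj[of u v] d by auto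
  next
    fix e assume e: "e \<in> edges H"
    then obtain x y where xy: "e = {x, y}" "x \<in> verts H" "y \<in> verts H"
      using assms(3) unfolding simple_graph_def by blast
    then obtain u v where uv: "u \<in> verts F" "v \<in> verts F" "x = f u" "y = f v"
      using f unfolding bij_betw_def by blast
    then have "{u, v} \<in> edges F" using adj[of u v] e xy by auto
    moreover have "e = f ` {u, v}" using uv xy by auto
    ultimately show "e \<in> (`) f ` edges F" by blast
  qed
  then show ?thesis using card_image[OF inj] by simp
qed

lemma gen_ramsey_attained:
  assumes "finite (edges G)" "simple_graph H" "q \<le> card (edges H)"
  shows "\<exists>c. Hq_coloring G H q c \<and> card (c ` edges G) = gen_ramsey G H q"
proof -
  obtain c :: "'a set \<Rightarrow> nat" where c: "inj_on c (edges G)"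
    using assms(1) finite_imp_inj_to_nat_seg by blast
  have "Hq_coloring G H q c"
    unfolding Hq_coloring_def
  proof (intro allI impI, elim conjE)
    fix F assume F: "is_subgraph F G" "isomorphic F H"
    then have "card (c ` edges F) = card (edges F)"
      using c by (meson card_image inj_on_subset is_subgraph_def)
    also have "\<dots> = card (edges H)"
      using F assms(2) isomorphic_card_edges is_subgraph_def by blast
    finally show "q \<le> card (c ` edges F)" using assms(3) by simp
  qed
  then have "\<exists>k c. Hq_coloring G H q c \<and> card (c ` edges G) = k" by blast
  then show ?thesis unfolding gen_ramsey_def by (rule LeastI_ex)
qed

end

theory Submission
  imports Defs
begin

text \<open>Call the difference between the number of edges and the number of colors the number of
  repetitions; every copy of the complete bipartite graph with \<open>s\<close> left and \<open>t\<close> right vertices has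
  fewer than \<open>(s + t) div 2 - 1\<close> repetitions. Hence a color occurs fewer than \<open>t\<close> times at each left
  vertex, so each left vertex sees at least \<open>n / t\<close> colors. Let \<open>p = (t - s) div 2\<close>. If a color \<open>x\<close> is
  seen by \<open>s\<close> left vertices, two of which share \<open>p\<close> further colors, then \<open>s\<close> edges of color \<open>x\<close> and
  \<open>p\<close> pairs of edges in the shared colors span at most \<open>s + 2 * p \<le> t\<close> right vertices and give
  \<open>s - 1 + p = (s + t) div 2 - 1\<close> repetitions, which is forbidden. So any two left vertices that see
  \<open>x\<close> share at most \<open>p\<close> colors. If there are few colors, some color is seen by at least \<open>sqrt n\<close>
  left vertices, and the almost disjoint color sets of these have a union of order \<open>n * sqrt n\<close>.\<close>

section \<open>Finite sets: repeated values and almost disjoint unions\<close>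

lemma card_image_le_card_diff:
  assumes "finite X" "E \<subseteq> X"
  shows "card (f ` X) + card E \<le> card X + card (f ` E)"
proof -
  have "f ` X = f ` (X - E) \<union> f ` E"
    using assms by blast
  then have "card (f ` X) \<le> card (f ` (X - E)) + card (f ` E)"
    by (simp add: card_Un_le)
  also have "\<dots> \<le> card (X - E) + card (f ` E)"
    using assms by (simp add: card_image_le)
  also have "card (X - E) = card X - card E"
    using assms by (simp add: card_Diff_subset finite_subset)
  finally show ?thesis
    using card_mono[OF assms] by linarith
qed

text \<open>Adding the sets one by one, each new set meets the union of the \<open>k\<close> earlier
  ones in at most \<open>k * p\<close> elements, so it contributes at least \<open>d - k * p\<close>
  new ones. Replacing every \<open>k\<close> by \<open>card A\<close> loses only a constant factor
  later.\<close>

lemma card_Union_almost_disjoint: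
  fixes d p :: real
  assumes "finite A" "\<And>a. a \<in> A \<Longrightarrow> finite (C a)" "\<And>a. a \<in> A \<Longrightarrow> d \<le> card (C a)"
    and "\<And>a b. a \<in> A \<Longrightarrow> b \<in> A \<Longrightarrow> a \<noteq> b \<Longrightarrow> card (C a \<inter> C b) \<le> p" and "0 \<le> p"
  shows "card A * (d - card A * p) \<le> card (\<Union>a\<in>A. C a)"
  using assms(1-4)
proof (induction A rule: finite_induct)
  case empty
  then show ?case by simp
next
  case (insert x A)
  let ?U = "\<Union>a\<in>A. C a"
  have fin: "finite ?U" "finite (C x)"
    using insert by auto
  have IH: "card A * (d - card A * p) \<le> card ?U"
    using insert by auto
  have "card (C x \<inter> ?U) = card (\<Union>a\<in>A. C x \<inter> C a)"
    by simp
  also have "real \<dots> \<le> (\<Sum>a\<in>A. real (card (C x \<inter> C a)))"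
    using card_UN_le[OF insert.hyps(1), of "\<lambda>a. C x \<inter> C a"] by (simp flip: of_nat_sum)
  also have "\<dots> \<le> card A * p"
    using insert.hyps insert.prems(3)[of x] by (intro sum_bounded_above) auto
  finally have inter: "card (C x \<inter> ?U) \<le> card A * p" .
  have "card (C x) + card ?U = card (C x \<union> ?U) + card (C x \<inter> ?U)"
    using card_Un_Int fin by blast
  then have "d + card A * (d - card A * p) - card A * p \<le> card (C x \<union> ?U)"
    using IH inter insert.prems(2)[of x] by simp
  moreover have "(1 + real (card A)) * (d - (1 + card A) * p)
      = d + card A * (d - card A * p) - card A * p - (1 + card A) * p"
    by (simp add: algebra_simps)
  moreover have "0 \<le> (1 + real (card A)) * p"
    using assms(5) by simp
  ultimately show ?case
    using insert.hyps by simp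
qed

section \<open>From edge colorings to colored grids\<close>

lemma Hq_coloring_complete_bipartite:
  assumes c: "Hq_coloring (complete_bipartite m n) (complete_bipartite s t) q c"
    and S: "S \<subseteq> {..<m}" "card S = s" and T: "T \<subseteq> {..<n}" "card T = t"
  shows "q \<le> card ((\<lambda>(i, j). c {Inl i, Inr j}) ` (S \<times> T))"
proof -
  define F :: "(nat + nat) ugraph" where
    "F = \<lparr>verts = Inl ` S \<union> Inr ` T, edges = (\<lambda>(i, j). {Inl i, Inr j}) ` (S \<times> T)\<rparr>"
  have sub: "is_subgraph F (complete_bipartite m n)"
    using S T by (auto simp: is_subgraph_def simple_graph_def F_def complete_bipartite_def)
  have "finite S" "finite T"
    using S T finite_subset by blast+
  then obtain g h where g: "bij_betw g S {..<s}" and h: "bij_betw h T {..<t}"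
    using S T by (metis atLeast0LessThan ex_bij_betw_finite_nat)
  have "isomorphic F (complete_bipartite s t)"
    unfolding isomorphic_def
  proof (intro exI conjI)
    show "bij_betw (map_sum g h) (verts F) (verts (complete_bipartite s t))"
    proof (rule bij_betw_imageI)
      show "inj_on (map_sum g h) (verts F)"
        by (intro inj_onI) (auto simp: F_def dest: inj_onD[OF bij_betw_imp_inj_on[OF g]]
            inj_onD[OF bij_betw_imp_inj_on[OF h]])
      have "map_sum g h ` verts F = Inl ` g ` S \<union> Inr ` h ` T"
        by (simp add: F_def image_Un image_image)
      then show "map_sum g h ` verts F = verts (complete_bipartite s t)"
        using g h by (simp add: complete_bipartite_def bij_betw_def)
    qed
    have gs: "g i < s" if "i \<in> S" for i
      using g that by (auto simp: bij_betw_def)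
    have ht: "h j < t" if "j \<in> T" for j
      using h that by (auto simp: bij_betw_def)
    show "\<forall>u\<in>verts F. \<forall>v\<in>verts F. ({u, v} \<in> edges F)
        = ({map_sum g h u, map_sum g h v} \<in> edges (complete_bipartite s t))"
      using gs ht by (auto simp: F_def complete_bipartite_def doubleton_eq_iff)
  qed
  with c sub have "q \<le> card (c ` edges F)"
    unfolding Hq_coloring_def by blast
  also have "c ` edges F = (\<lambda>(i, j). c {Inl i, Inr j}) ` (S \<times> T)"
    by (auto simp: F_def image_image split_def)
  finally show ?thesis .
qed

text \<open>Rows are left vertices, columns right vertices, and a cell is an edge. Copies with the
  \<open>s\<close>-side on the left are enough for the lower bound.\<close>

locale grid_coloring =
  fixes n s t :: nat and f :: "nat \<times> nat \<Rightarrow> nat"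
  assumes st: "0 < s" "s \<le> t" "t \<le> n"
    and many_colors: "\<And>S T. S \<subseteq> {..<n} \<Longrightarrow> card S = s \<Longrightarrow> T \<subseteq> {..<n} \<Longrightarrow> card T = t \<Longrightarrow>
      s * t - (s + t) div 2 + 2 \<le> card (f ` (S \<times> T))"
begin

definition colors_at :: "nat \<Rightarrow> nat set" where
  "colors_at a = (\<lambda>b. f (a, b)) ` {..<n}"

lemma finite_colors_at [simp]: "finite (colors_at a)"
  by (simp add: colors_at_def)

text \<open>Enlarge \<open>E\<close> to a full \<open>s\<close> by \<open>t\<close> grid: each added
  cell brings at most one new color, so repetitions are never lost. The additive form avoids
  truncated subtraction.\<close>

lemma few_repetitions:
  assumes E: "E \<subseteq> {..<n} \<times> {..<n}" and "card (fst ` E) \<le> s" "card (snd ` E) \<le> t"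
  shows "card E + 2 \<le> (s + t) div 2 + card (f ` E)"
proof -
  have "fst ` E \<subseteq> {..<n}" "snd ` E \<subseteq> {..<n}"
    using E by auto
  then obtain S T where S: "fst ` E \<subseteq> S" "S \<subseteq> {..<n}" "card S = s"
    and T: "snd ` E \<subseteq> T" "T \<subseteq> {..<n}" "card T = t"
    using exists_subset_between[of "fst ` E" s "{..<n}"]
      exists_subset_between[of "snd ` E" t "{..<n}"] assms st by auto
  have "E \<subseteq> S \<times> T"
    using S(1) T(1) by force
  moreover have "finite (S \<times> T)"
    using S T by (meson finite_SigmaI finite_lessThan finite_subset)
  ultimately have "card (f ` (S \<times> T)) + card E \<le> s * t + card (f ` E)"
    using card_image_le_card_diff S T by (metis card_cartesian_product)
  moreover have "s * t - (s + t) div 2 + 2 \<le> card (f ` (S \<times> T))"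
    using many_colors S T by blast
  ultimately show ?thesis
    by linarith
qed

lemma card_colors_at:
  assumes "a < n"
  shows "n \<le> t * card (colors_at a)"
proof -
  \<comment> \<open>Already \<open>t\<close> equal cells in a row are \<open>t - 1\<close>
    repetitions, but at most \<open>(s + t) div 2 - 2 \<le> t - 2\<close> are allowed.\<close>
  have fiber: "card {b \<in> {..<n}. f (a, b) = x} \<le> t" for x
  proof (rule ccontr)
    assume "\<not> ?thesis"
    then obtain T where T: "T \<subseteq> {b \<in> {..<n}. f (a, b) = x}" "card T = t"
      using obtain_subset_with_card_n[of t] by (metis nat_le_linear)
    have "f ` ({a} \<times> T) \<subseteq> {x}"
      using T by auto
    then have "card (f ` ({a} \<times> T)) \<le> 1"
      using card_mono[of "{x}"] by simp
    moreover have "card ({a} \<times> T) + 2 \<le> (s + t) div 2 + card (f ` ({a} \<times> T))"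
    proof (rule few_repetitions)
      show "{a} \<times> T \<subseteq> {..<n} \<times> {..<n}"
        using T assms by auto
      have "fst ` ({a} \<times> T) \<subseteq> {a}"
        by auto
      then have "card (fst ` ({a} \<times> T)) \<le> 1"
        using card_mono[of "{a}"] by simp
      then show "card (fst ` ({a} \<times> T)) \<le> s"
        using st by linarith
      show "card (snd ` ({a} \<times> T)) \<le> t"
        using T by simp
    qed
    ultimately show False
      using T st by (simp add: card_cartesian_product)
  qed
  have "n = (\<Sum>x\<in>colors_at a. card {b \<in> {..<n}. f (a, b) = x})"
    using sum.image_gen[of "{..<n}" "\<lambda>_. 1::nat" "\<lambda>b. f (a, b)"] by (simp add: colors_at_def)
  also have "\<dots> \<le> t * card (colors_at a)"
    using sum_bounded_above[of "colors_at a", OF fiber] by (simp add: mult.commute)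
  finally show ?thesis .
qed

section \<open>Rows that see a common color\<close>

lemma card_common_colors:
  assumes A: "A \<subseteq> {a \<in> {..<n}. x \<in> colors_at a}" "s \<le> card A"
    and ab: "a \<in> A" "b \<in> A" "a \<noteq> b" and "2 \<le> s"
  shows "card (colors_at a \<inter> colors_at b) \<le> (t - s) div 2"
proof (rule ccontr)
  define p where "p = (t - s) div 2"
  assume "\<not> ?thesis"
  \<comment> \<open>There are at least \<open>p + 1\<close> common colors, and \<open>x\<close> is
    one of them.\<close>
  then have "p \<le> card (colors_at a \<inter> colors_at b - {x})"
    using A ab by (subst card_Diff_singleton) (auto simp: p_def)
  then obtain P where P: "P \<subseteq> colors_at a \<inter> colors_at b - {x}" "card P = p" "finite P"
    by (rule obtain_subset_with_card_n)
  have "finite A"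
    using A(1) finite_subset by fastforce
  then obtain S where S: "{a, b} \<subseteq> S" "S \<subseteq> A" "card S = s"
    using exists_subset_between[of "{a, b}" s A] A ab \<open>2 \<le> s\<close> by auto
  have finS: "finite S"
    using S \<open>finite A\<close> finite_subset by blast
  \<comment> \<open>The forbidden cells are indexed by (row, color), and \<open>g\<close> picks a
    column for each. The color of a cell recovers its index, so distinct indices give distinct
    cells.\<close>
  define I where "I = S \<times> {x} \<union> {a, b} \<times> P"
  have finI: "finite I"
    using P finS by (simp add: I_def)
  have "y \<in> colors_at i" if "(i, y) \<in> I" for i y
    using that A S P by (auto simp: I_def)
  then have "\<exists>j<n. f (i, j) = y" if "(i, y) \<in> I" for i y
    using that by (fastforce simp: colors_at_def)
  then obtain g where g: "\<And>i y. (i, y) \<in> I \<Longrightarrow> g i y < n \<and> f (i, g i y) = y"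
    by metis
  define e where "e = (\<lambda>(i, y). (i, g i y))"
  have fe: "f (e z) = snd z" "fst (e z) = fst z" if "z \<in> I" for z
    using g that by (auto simp: e_def split_def)
  have inj: "inj_on e I"
    by (intro inj_onI) (metis fe prod_eq_iff)
  have "card I = card (S \<times> {x}) + card ({a, b} \<times> P)"
    unfolding I_def using P finS by (intro card_Un_disjoint) auto
  then have cI: "card I = s + 2 * p"
    using P S ab by (simp add: card_cartesian_product)
  have "f ` e ` I = snd ` I"
    using fe by (simp add: image_image)
  then have "f ` e ` I \<subseteq> insert x P"
    by (auto simp: I_def)
  then have "card (f ` e ` I) \<le> card (insert x P)"
    using P by (intro card_mono) auto
  also have "\<dots> = p + 1"
    using P by (subst card_insert_disjoint) auto
  finally have cf: "card (f ` e ` I) \<le> p + 1" .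
  have "card (e ` I) + 2 \<le> (s + t) div 2 + card (f ` e ` I)"
  proof (rule few_repetitions)
    show "e ` I \<subseteq> {..<n} \<times> {..<n}"
      using g A S by (auto simp: I_def e_def)
    have "fst ` e ` I = fst ` I"
      using fe by (simp add: image_image)
    also have "\<dots> \<subseteq> S"
      using S by (auto simp: I_def)
    finally show "card (fst ` e ` I) \<le> s"
      using S finS card_mono by blast
    \<comment> \<open>Columns may coincide, but even distinct ones number only
      \<open>s + 2 * p \<le> t\<close>; this dictates the choice of \<open>p\<close>.\<close>
    have "card (snd ` e ` I) \<le> card I"
      using finI by (metis card_image_le finite_imageI image_image)
    then show "card (snd ` e ` I) \<le> t"
      using cI st by (simp add: p_def)
  qed
  \<comment> \<open>Since \<open>s + p = (s + t) div 2\<close>, this fails by exactly one.\<close>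
  then have "s + 2 * p + 2 \<le> (s + t) div 2 + (p + 1)"
    using cf cI card_image[OF inj] by linarith
  then show False
    using st unfolding p_def by linarith
qed

section \<open>Counting colors in the grid\<close>

lemma exists_popular_color:
  fixes r :: real
  assumes less: "t * r * card (f ` ({..<n} \<times> {..<n})) < n * n"
  obtains x where "r < card {a \<in> {..<n}. x \<in> colors_at a}"
proof (rule ccontr)
  let ?C = "f ` ({..<n} \<times> {..<n})"
  let ?A = "\<lambda>x. {a \<in> {..<n}. x \<in> colors_at a}"
  assume "\<not> thesis"
  then have le: "card (?A x) \<le> r" for x
    using that not_less by blast
  have sub: "{x \<in> ?C. x \<in> colors_at a} = colors_at a" if "a \<in> {..<n}" for a
    using that by (auto simp: colors_at_def)
  have "n * n = (\<Sum>a<n. n)"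
    by simp
  also have "\<dots> \<le> (\<Sum>a<n. t * card (colors_at a))"
    by (intro sum_mono card_colors_at) simp
  also have "\<dots> = t * (\<Sum>a<n. card {x \<in> ?C. x \<in> colors_at a})"
    by (simp add: sub sum_distrib_left)
  \<comment> \<open>Double counting of the pairs of a row and a color seen in it.\<close>
  also have "(\<Sum>a<n. card {x \<in> ?C. x \<in> colors_at a}) = (\<Sum>x\<in>?C. card (?A x))"
    by (rule sum_multicount_gen) auto
  finally have "real (n * n) \<le> real (t * (\<Sum>x\<in>?C. card (?A x)))"
    by (rule of_nat_mono)
  then have "real n * n \<le> t * (\<Sum>x\<in>?C. real (card (?A x)))"
    by simp
  also have "\<dots> \<le> t * (card ?C * r)"
    by (intro mult_left_mono sum_bounded_above le) simp
  finally show False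
    using less by (simp add: mult_ac)
qed

lemma card_colors_ge:
  assumes "2 \<le> s" and big: "4 * real t ^ 2 \<le> sqrt n"
  shows "n * sqrt n \<le> 2 * t * card (f ` ({..<n} \<times> {..<n}))"
proof (rule ccontr)
  let ?C = "f ` ({..<n} \<times> {..<n})"
  define r where "r = sqrt (real n)"
  have n: "real n = r * r"
    by (simp add: r_def)
  have t: "1 \<le> real t"
    using st by simp
  then have "real t \<le> real t ^ 2"
    by (simp add: power2_eq_square)
  with big t have r: "real t \<le> r" "1 \<le> r"
    unfolding r_def by linarith+
  assume "\<not> ?thesis"
  then have neg: "2 * t * card ?C < n * r"
    by (simp add: r_def)
  moreover have "0 \<le> real t * card ?C"
    by simp
  ultimately have "t * card ?C < n * r"
    by linarith
  then have "t * r * card ?C < n * n"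
    using r by (simp add: n mult_ac)
  then obtain x where x: "r < card {a \<in> {..<n}. x \<in> colors_at a}"
    using exists_popular_color by blast
  \<comment> \<open>Only about \<open>sqrt n\<close> of the popular rows are kept: with too many
    rows the overlap term \<open>card A * t\<close> could exceed \<open>n / t\<close>.\<close>
  define m where "m = nat \<lceil>r\<rceil>"
  have m: "r \<le> m" "m \<le> 2 * r"
    using r unfolding m_def by linarith+
  have "m \<le> card {a \<in> {..<n}. x \<in> colors_at a}"
    using x unfolding m_def by linarith
  then obtain A where A: "A \<subseteq> {a \<in> {..<n}. x \<in> colors_at a}" "card A = m" "finite A"
    by (rule obtain_subset_with_card_n)
  have "s \<le> m"
    using st r m by linarith
  have "card A * (n / t - card A * real t) \<le> card (\<Union>a\<in>A. colors_at a)"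
  proof (rule card_Union_almost_disjoint)
    fix a assume "a \<in> A"
    then have "real n \<le> t * card (colors_at a)"
      using card_colors_at A by (metis (no_types, lifting) lessThan_iff mem_Collect_eq
          of_nat_le_iff of_nat_mult subsetD)
    then show "n / t \<le> card (colors_at a)"
      using t by (simp add: divide_le_eq mult.commute)
  next
    fix a b assume "a \<in> A" "b \<in> A" "a \<noteq> b"
    then have "card (colors_at a \<inter> colors_at b) \<le> (t - s) div 2"
      using card_common_colors[of A x] A \<open>s \<le> m\<close> \<open>2 \<le> s\<close> by simp
    then have "card (colors_at a \<inter> colors_at b) \<le> t"
      by linarith
    then show "real (card (colors_at a \<inter> colors_at b)) \<le> t"
      by simp
  qed (use A in auto)
  also have "card (\<Union>a\<in>A. colors_at a) \<le> card ?C"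
    using A by (intro card_mono) (auto simp: colors_at_def)
  finally have upper: "m * (n / t - m * t) \<le> card ?C"
    using A by simp
  \<comment> \<open>The assumption \<open>big\<close> makes the overlaps cost at most half of
    \<open>n / t\<close>. Each of the \<open>m \<ge> r\<close> rows thus still accounts for
    \<open>n / (2 * t)\<close> colors, whence the constant \<open>2 * t\<close>.\<close>
  have "m * real t \<le> 2 * r * t"
    using m by (intro mult_right_mono) auto
  also have "\<dots> \<le> n / (2 * t)"
  proof -
    have "r * (4 * real t ^ 2) \<le> r * r"
      using big r by (intro mult_left_mono) (auto simp: r_def)
    then show ?thesis
      using t by (simp add: n field_simps power2_eq_square)
  qed
  finally have "n / (2 * t) \<le> n / t - m * t"
    using t by (simp add: field_simps)
  then have "r * (n / (2 * t)) \<le> m * (n / t - m * t)"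
    using m r by (intro mult_mono) auto
  with upper have "r * (n / (2 * t)) \<le> card ?C"
    by linarith
  then show False
    using neg t by (simp add: field_simps)
qed

end

section \<open>The asymptotic bound\<close>

theorem theorem1p5:
  fixes s t :: nat
  assumes "3 \<le> s" and "s \<le> t"
  shows "(\<lambda>n. real (gen_ramsey (complete_bipartite n n) (complete_bipartite s t)
                       (s * t - (s + t) div 2 + 2)))
           \<in> \<Omega>(\<lambda>n. real n powr (3 / 2))"
proof (rule landau_omega.bigI)
  let ?q = "s * t - (s + t) div 2 + 2"
  let ?R = "\<lambda>n. gen_ramsey (complete_bipartite n n) (complete_bipartite s t) ?q"
  show "0 < 1 / (2 * real t)"
    using assms by simp
  \<comment> \<open>This keeps the subtraction in \<open>?q\<close> from truncating, so that
    \<open>?q \<le> s * t\<close> and the minimum defining \<open>gen_ramsey\<close> is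
    attained.\<close>
  have "3 * t \<le> s * t"
    using assms by simp
  then have q: "?q \<le> card (edges (complete_bipartite s t))"
    unfolding card_edges_complete_bipartite using assms by linarith
  \<comment> \<open>The threshold is the square of \<open>4 * t ^ 2 \<le> sqrt n\<close>; it also
    ensures \<open>t \<le> n\<close>.\<close>
  have "1 / (2 * real t) * (real n powr (3 / 2)) \<le> ?R n" if n: "(4 * t ^ 2) ^ 2 \<le> n" for n
  proof -
    obtain c where c: "Hq_coloring (complete_bipartite n n) (complete_bipartite s t) ?q c"
      "card (c ` edges (complete_bipartite n n)) = ?R n"
      using gen_ramsey_attained[OF finite_edges_complete_bipartite
          simple_graph_complete_bipartite q] by blast
    have "t \<le> (4 * t ^ 2) ^ 2"
      using assms by (simp add: power2_eq_square)
    then have "t \<le> n"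
      using n by linarith
    interpret grid_coloring n s t "\<lambda>(i, j). c {Inl i, Inr j}"
      using Hq_coloring_complete_bipartite[OF c(1)] assms \<open>t \<le> n\<close> by unfold_locales auto
    have "real ((4 * t ^ 2) ^ 2) \<le> n"
      using n of_nat_le_iff by blast
    then have "4 * real t ^ 2 \<le> sqrt n"
      by (intro real_le_rsqrt) simp
    then have "n * sqrt n \<le> 2 * t * card ((\<lambda>(i, j). c {Inl i, Inr j}) ` ({..<n} \<times> {..<n}))"
      using card_colors_ge assms by simp
    also have "(\<lambda>(i, j). c {Inl i, Inr j}) ` ({..<n} \<times> {..<n}) = c ` edges (complete_bipartite n n)"
      by (simp add: edges_complete_bipartite image_image split_def)
    finally have "n * sqrt n \<le> 2 * t * ?R n"
      using c(2) by simp
    moreover have "real n powr (3 / 2) = n * sqrt n"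
      using \<open>t \<le> n\<close> assms powr_add[of "real n" 1 "1 / 2"] by (simp add: powr_half_sqrt)
    ultimately show ?thesis
      using assms by (simp add: field_simps)
  qed
  then show "\<forall>\<^sub>F n in at_top. 1 / (2 * real t) * norm (real n powr (3 / 2)) \<le> norm (real (?R n))"
    by (intro eventually_at_top_linorderI[of "(4 * t ^ 2) ^ 2"]) auto
qed

end
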